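(* Let $A$ be an infinite set. (1) Let $f\colon(X,\mathcal{U})\to(Y,\mathcal{V})$ be a uniformly continuous map of uniform spaces. Then $Z(\mathfrak{B}_{A}(f))\circ\mathcal{C}_{(X,\mathcal{U})}=\mathcal{C}_{(Y,\mathcal{V})}\circ f$. (2) Let $\mathcal{L},\mathcal{M}\in V(\Omega(A))$ and let $\phi\colon\mathcal{L}\to\mathcal{M}$ be a homomorphism. Then $\mathfrak{B}_{A}(Z(\phi))\circ\rho_{\mathcal{L}}=\rho_{\mathcal{M}}\circ\phi$. (3) For every $\mathcal{L}\in V(\Omega(A))$, the functions $Z(\rho_{\mathcal{L}})\colon Z(\mathfrak{B}_{A}(Z(\mathcal{L})))\to Z(\mathcal{L})$ and $\mathcal{C}_{Z(\mathcal{L})}\colon Z(\mathcal{L})\to Z(\mathfrak{B}_{A}(Z(\mathcal{L})))$ are inverses of each other. (4) For every uniform space $(X,\mathcal{U})$, the functions $\mathfrak{B}_{A}(\mathcal{C}_{(X,\mathcal{U})})\colon\mathfrak{B}_{A}(Z(\mathfrak{B}_{A}(X,\mathcal{U})))\to\mathfrak{B}_{A}(X,\mathcal{U})$ and $\rho_{\mathfrak{B}_{A}(X,\mathcal{U})}\colon\mathfrak{B}_{A}(X,\mathcal{U})\to\mathfrak{B}_{A}(Z(\mathfrak{B}_{A}(X,\mathcal{U})))$ are inverses of each other.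
   Context: $\Omega(A)$ is the algebra with universe $A$ whose signature has a constant symbol $\hat a$ for each $a\in A$, interpreted as $a$, and an $n$-ary function symbol $\hat f$ for each function $f\colon A^n\to A$ (all finite $n$), interpreted as $f$. $V(\Omega(A))$ is the variety generated by $\Omega(A)$. For $\mathcal{L}\in V(\Omega(A))$, $Z(\mathcal{L})$ is the set of all homomorphisms $\mathcal{L}\to\Omega(A)$, with the uniformity it inherits as a subspace of $A^{\mathcal{L}}$, where $A$ has the discrete uniformity and $A^{\mathcal{L}}$ the product uniformity. For a uniform space $(X,\mathcal{U})$, $\mathfrak{B}_{A}(X,\mathcal{U})$ is the algebra of all uniformly continuous maps $X\to A$ ($A$ with the discrete uniformity), with pointwise operations, a subalgebra of $\Omega(A)^{X}$. The map $\rho_{\mathcal{L}}\colon\mathcal{L}\to\mathfrak{B}_{A}(Z(\mathcal{L}))$ is the homomorphism $\rho_{\mathcal{L}}(\ell)(\phi)=\phi(\ell)$; the map $\mathcal{C}_{(X,\mathcal{U})}\colon X\to Z(\mathfrak{B}_{A}(X,\mathcal{U}))$ is the uniformly continuous map $\mathcal{C}_{(X,\mathcal{U})}(x)(f)=f(x)$. For a homomorphism $\phi\colon\mathcal{L}\to\mathcal{M}$ in $V(\Omega(A))$, $Z(\phi)\colon Z(\mathcal{M})\to Z(\mathcal{L})$ is the uniformly continuous map $Z(\phi)(\theta)=\theta\circ\phi$. For a uniformly continuous $f\colon(X,\mathcal{U})\to(Y,\mathcal{V})$, $\mathfrak{B}_{A}(f)\colon\mathfrak{B}_{A}(Y,\mathcal{V})\to\mathfrak{B}_{A}(X,\mathcal{U})$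 is the homomorphism $\mathfrak{B}_{A}(f)(g)=g\circ f$. *)

theory Defs
  imports Complex_Main "HOL-Library.FuncSet"
begin

text \<open>
  Maps whose domain is a carrier set \<open>S\<close> are taken in \<open>S \<rightarrow>\<^sub>E T\<close> (they are \<open>undefined\<close> outside
  \<open>S\<close>), so that HOL equality of such maps is equality of functions on \<open>S\<close>, and \<open>compose S g f\<close> is
  the composite of \<open>f\<close> with domain \<open>S\<close> and \<open>g\<close>.
\<close>

section \<open>Algebras over the signature of \<open>\<Omega>(A)\<close>\<close>

definition tuples :: "'b set \<Rightarrow> nat \<Rightarrow> 'b list set" where
  "tuples S n = {xs. length xs = n \<and> set xs \<subseteq> S}"

datatype 'a opsym = Cst 'a | Fn nat "'a list \<Rightarrow> 'a"

primrec arity :: "'a opsym \<Rightarrow> nat" where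
  "arity (Cst a) = 0"
| "arity (Fn n f) = n"

definition syms :: "'a set \<Rightarrow> 'a opsym set" where
  "syms A = Cst ` A \<union> {Fn n f | n f. f \<in> tuples A n \<rightarrow>\<^sub>E A}"

text \<open>Only the values of \<open>interp s\<close> on tuples of length \<open>arity s\<close> from the carrier matter.\<close>

record ('a, 'b) algebra =
  carrier :: "'b set"
  interp :: "'a opsym \<Rightarrow> 'b list \<Rightarrow> 'b"

definition is_algebra :: "'a set \<Rightarrow> ('a, 'b) algebra \<Rightarrow> bool" where
  "is_algebra A L \<longleftrightarrow>
     (\<forall>s \<in> syms A. \<forall>xs \<in> tuples (carrier L) (arity s). interp L s xs \<in> carrier L)"

definition hom :: "'a set \<Rightarrow> ('a, 'b) algebra \<Rightarrow> ('a, 'c) algebra \<Rightarrow> ('b \<Rightarrow> 'c) set" where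
  "hom A L M = {h \<in> carrier L \<rightarrow>\<^sub>E carrier M.
     \<forall>s \<in> syms A. \<forall>xs \<in> tuples (carrier L) (arity s). h (interp L s xs) = interp M s (map h xs)}"

primrec omega_interp :: "'a opsym \<Rightarrow> 'a list \<Rightarrow> 'a" where
  "omega_interp (Cst a) = (\<lambda>_. a)"
| "omega_interp (Fn n f) = f"

definition Omega :: "'a set \<Rightarrow> ('a, 'a) algebra" where
  "Omega A = \<lparr>carrier = A, interp = omega_interp\<rparr>"

definition power_algebra :: "'a set \<Rightarrow> 'x set \<Rightarrow> ('a, 'x \<Rightarrow> 'a) algebra" where
  "power_algebra A X = \<lparr>carrier = X \<rightarrow>\<^sub>E A,
     interp = (\<lambda>s gs. \<lambda>x\<in>X. interp (Omega A) s (map (\<lambda>g. g x) gs))\<rparr>"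


section \<open>The variety generated by \<open>\<Omega>(A)\<close>\<close>

datatype 'a trm = Var nat | App "'a opsym" "'a trm list"

inductive_set terms :: "'a set \<Rightarrow> 'a trm set" for A where
  "Var i \<in> terms A"
| "\<lbrakk>s \<in> syms A; length ts = arity s; \<forall>t \<in> set ts. t \<in> terms A\<rbrakk> \<Longrightarrow> App s ts \<in> terms A"

primrec eval_term :: "('a, 'b) algebra \<Rightarrow> (nat \<Rightarrow> 'b) \<Rightarrow> 'a trm \<Rightarrow> 'b" where
  "eval_term L v (Var i) = v i"
| "eval_term L v (App s ts) = interp L s (map (eval_term L v) ts)"

definition models :: "('a, 'b) algebra \<Rightarrow> ('a trm \<times> 'a trm) set \<Rightarrow> bool" where
  "models L E \<longleftrightarrow>
     (\<forall>(t, u) \<in> E. \<forall>v. range v \<subseteq> carrier L \<longrightarrow> eval_term L v t = eval_term L v u)"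

text \<open>
  A variety is the class of all algebras satisfying some set \<open>E\<close> of identities; the variety generated
  by \<open>\<Omega>(A)\<close> is the least one that contains \<open>\<Omega>(A)\<close>. Membership is a predicate because the class ranges
  over algebras with carriers in arbitrary types.
\<close>

definition in_variety :: "'a set \<Rightarrow> ('a, 'b) algebra \<Rightarrow> bool" where
  "in_variety A L \<longleftrightarrow> is_algebra A L \<and>
     (\<forall>E \<subseteq> terms A \<times> terms A. models (Omega A) E \<longrightarrow> models L E)"


section \<open>Uniform spaces with an explicit carrier\<close>

text \<open>
  As in the type class \<open>uniform_space\<close>, the uniformity is a filter on pairs; relative to a carrier \<open>X\<close>
  it lives on \<open>X \<times> X\<close>, and its entourages are the sets \<open>{p \<in> X \<times> X. P p}\<close> with
  \<open>eventually P\<close>. On the empty carrier it is the filter \<open>bot\<close>, with sole entourage \<open>{}\<close>.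
\<close>

record 'x uspace =
  points :: "'x set"
  unif :: "('x \<times> 'x) filter"

definition is_uspace :: "'x uspace \<Rightarrow> bool" where
  "is_uspace X \<longleftrightarrow>
     unif X \<le> principal (points X \<times> points X) \<and>
     (\<forall>E. eventually E (unif X) \<longrightarrow>
        (\<forall>x \<in> points X. E (x, x)) \<and>
        eventually (\<lambda>(x, y). E (y, x)) (unif X) \<and>
        (\<exists>D. eventually D (unif X) \<and> (\<forall>x y z. D (x, y) \<longrightarrow> D (y, z) \<longrightarrow> E (x, z))))"

definition ucont :: "'x uspace \<Rightarrow> 'y uspace \<Rightarrow> ('x \<Rightarrow> 'y) set" where
  "ucont X Y = {f \<in> points X \<rightarrow>\<^sub>E points Y. filterlim (\<lambda>(x, y). (f x, f y)) (unif Y) (unif X)}"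

definition discrete_uspace :: "'a set \<Rightarrow> 'a uspace" where
  "discrete_uspace A = \<lparr>points = A, unif = principal (Id_on A)\<rparr>"

text \<open>The power \<open>X\<^sup>I\<close> with the product uniformity.\<close>

definition power_uspace :: "'x uspace \<Rightarrow> 'i set \<Rightarrow> ('i \<Rightarrow> 'x) uspace" where
  "power_uspace X I = \<lparr>points = I \<rightarrow>\<^sub>E points X,
     unif = inf (INF i\<in>I. filtercomap (\<lambda>(f, g). (f i, g i)) (unif X))
       (principal ((I \<rightarrow>\<^sub>E points X) \<times> (I \<rightarrow>\<^sub>E points X)))\<rparr>"

definition sub_uspace :: "'x uspace \<Rightarrow> 'x set \<Rightarrow> 'x uspace" where
  "sub_uspace X S = \<lparr>points = S, unif = inf (unif X) (principal (S \<times> S))\<rparr>"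


section \<open>The functors \<open>Z\<close> and \<open>\<BB>\<^sub>A\<close>, and the maps \<open>\<rho>\<close> and \<open>\<C>\<close>\<close>

definition Z :: "'a set \<Rightarrow> ('a, 'b) algebra \<Rightarrow> ('b \<Rightarrow> 'a) uspace" where
  "Z A L = sub_uspace (power_uspace (discrete_uspace A) (carrier L)) (hom A L (Omega A))"

definition B :: "'a set \<Rightarrow> 'x uspace \<Rightarrow> ('a, 'x \<Rightarrow> 'a) algebra" where
  "B A X = (power_algebra A (points X))\<lparr>carrier := ucont X (discrete_uspace A)\<rparr>"

definition rho :: "'a set \<Rightarrow> ('a, 'b) algebra \<Rightarrow> 'b \<Rightarrow> ('b \<Rightarrow> 'a) \<Rightarrow> 'a" where
  "rho A L = (\<lambda>l \<in> carrier L. \<lambda>\<phi> \<in> points (Z A L). \<phi> l)"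

definition C :: "'a set \<Rightarrow> 'x uspace \<Rightarrow> 'x \<Rightarrow> ('x \<Rightarrow> 'a) \<Rightarrow> 'a" where
  "C A X = (\<lambda>x \<in> points X. \<lambda>f \<in> carrier (B A X). f x)"

definition Z_map :: "'a set \<Rightarrow> ('a, 'b) algebra \<Rightarrow> ('a, 'c) algebra \<Rightarrow> ('b \<Rightarrow> 'c) \<Rightarrow>
    ('c \<Rightarrow> 'a) \<Rightarrow> ('b \<Rightarrow> 'a)" where
  "Z_map A L M \<phi> = (\<lambda>\<theta> \<in> points (Z A M). compose (carrier L) \<theta> \<phi>)"

definition B_map :: "'a set \<Rightarrow> 'x uspace \<Rightarrow> 'y uspace \<Rightarrow> ('x \<Rightarrow> 'y) \<Rightarrow>
    ('y \<Rightarrow> 'a) \<Rightarrow> ('x \<Rightarrow> 'a)" where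
  "B_map A X Y f = (\<lambda>g \<in> carrier (B A Y). compose (points X) g f)"

definition mutually_inverse :: "'s set \<Rightarrow> 't set \<Rightarrow> ('s \<Rightarrow> 't) \<Rightarrow> ('t \<Rightarrow> 's) \<Rightarrow> bool" where
  "mutually_inverse S T f g \<longleftrightarrow>
     f \<in> S \<rightarrow>\<^sub>E T \<and> g \<in> T \<rightarrow>\<^sub>E S \<and> (\<forall>x\<in>S. g (f x) = x) \<and> (\<forall>y\<in>T. f (g y) = y)"


section \<open>Well-definedness\<close>

lemma tuplesD: "xs \<in> tuples S n \<Longrightarrow> length xs = n" "xs \<in> tuples S n \<Longrightarrow> x \<in> set xs \<Longrightarrow> x \<in> S"
  by (auto simp: tuples_def)

lemma map_tuples: "xs \<in> tuples S n \<Longrightarrow> (\<And>x. x \<in> S \<Longrightarrow> h x \<in> T) \<Longrightarrow> map h xs \<in> tuples T n"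
  by (auto simp: tuples_def)

lemma carrier_Omega [simp]: "carrier (Omega A) = A"
  by (simp add: Omega_def)

lemma interp_Omega [simp]: "interp (Omega A) = omega_interp"
  by (simp add: Omega_def)

lemma carrier_B [simp]: "carrier (B A X) = ucont X (discrete_uspace A)"
  by (simp add: B_def)

lemma interp_B: "interp (B A X) s gs = (\<lambda>x\<in>points X. omega_interp s (map (\<lambda>g. g x) gs))"
  by (simp add: B_def power_algebra_def)

lemma points_Z [simp]: "points (Z A L) = hom A L (Omega A)"
  by (simp add: Z_def sub_uspace_def)

lemma unif_Z: "unif (Z A L) = inf (INF l\<in>carrier L. filtercomap (\<lambda>(f, g). (f l, g l)) (principal (Id_on A)))
   (principal (hom A L (Omega A) \<times> hom A L (Omega A)))"
proof -
  have "hom A L (Omega A) \<times> hom A L (Omega A) \<subseteq> (carrier L \<rightarrow>\<^sub>E A) \<times> (carrier L \<rightarrow>\<^sub>E A)"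
    by (auto simp: hom_def)
  then show ?thesis
    by (simp add: Z_def sub_uspace_def power_uspace_def discrete_uspace_def inf_assoc Int_absorb1)
qed

lemma omega_closed: "s \<in> syms A \<Longrightarrow> xs \<in> tuples A (arity s) \<Longrightarrow> omega_interp s xs \<in> A"
  by (auto simp: syms_def)

lemma in_variety_Omega: "in_variety A (Omega A)"
  by (auto simp: in_variety_def is_algebra_def omega_closed)

lemma ucont_discrete_iff:
  assumes "unif X \<le> principal (points X \<times> points X)"
  shows "f \<in> ucont X (discrete_uspace A) \<longleftrightarrow>
    f \<in> points X \<rightarrow>\<^sub>E A \<and> eventually (\<lambda>(x, y). f x = f y) (unif X)"
proof -
  have *: "eventually (\<lambda>p. p \<in> points X \<times> points X) (unif X)"
    using assms by (simp add: le_principal)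
  show ?thesis
    unfolding ucont_def discrete_uspace_def
    apply (simp add: filterlim_principal case_prod_beta)
    apply (rule conj_cong[OF refl])
    apply (rule iffI)
     apply (erule eventually_mono, force)
    apply (rule eventually_mono[OF eventually_conj[OF _ *]], assumption, force)
    done
qed

lemma ucont_Z_iff:
  assumes "unif X \<le> principal (points X \<times> points X)"
  shows "f \<in> ucont X (Z A L) \<longleftrightarrow>
    f \<in> points X \<rightarrow>\<^sub>E hom A L (Omega A) \<and>
    (\<forall>l\<in>carrier L. eventually (\<lambda>(x, y). f x l = f y l) (unif X))"
proof -
  have *: "eventually (\<lambda>p. p \<in> points X \<times> points X) (unif X)"
    using assms by (simp add: le_principal)
  show ?thesis
    unfolding ucont_def mem_Collect_eq points_Z
  proof (rule conj_cong[OF refl])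
    assume f: "f \<in> points X \<rightarrow>\<^sub>E hom A L (Omega A)"
    have 1: "eventually (\<lambda>p. (case p of (x, y) \<Rightarrow> (f x, f y)) \<in> hom A L (Omega A) \<times> hom A L (Omega A)) (unif X)"
      by (rule eventually_mono[OF *]) (use f in auto)
    have 2: "eventually (\<lambda>p. (case (case p of (x, y) \<Rightarrow> (f x, f y)) of (f, g) \<Rightarrow> (f l, g l)) \<in> Id_on A) (unif X)
       \<longleftrightarrow> eventually (\<lambda>(x, y). f x l = f y l) (unif X)" if "l \<in> carrier L" for l
    proof -
      have m: "f x l \<in> A" if "x \<in> points X" for x
        using f that \<open>l \<in> carrier L\<close> by (auto simp: hom_def PiE_iff)
      show ?thesis
        apply (rule iffI)
         apply (erule eventually_mono, force)
        apply (rule eventually_mono[OF eventually_conj[OF _ *]], assumption)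
        using m by (force simp: Id_on_def)
    qed
    show "(LIM (x, y) unif X. (f x, f y) :> unif (Z A L)) =
      (\<forall>l\<in>carrier L. eventually (\<lambda>(x, y). f x l = f y l) (unif X))"
      unfolding unif_Z filterlim_inf filterlim_INF filterlim_filtercomap_iff comp_def filterlim_principal
      using 1 2 by simp
  qed
qed

lemma eventually_Z:
  "l \<in> carrier L \<Longrightarrow> eventually (\<lambda>(\<theta>, \<theta>'). \<theta> l = \<theta>' l) (unif (Z A L))"
  unfolding unif_Z
  apply (rule filter_leD[OF inf_le1])
  apply (rule filter_leD[OF INF_lower], assumption)
  apply (auto simp: eventually_filtercomap eventually_principal intro!: exI[of _ "\<lambda>(x, y). x = y"])
  done

lemma unif_Z_le: "unif (Z A L) \<le> principal (points (Z A L) \<times> points (Z A L))"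
  by (simp add: unif_Z)

lemma eventually_ball_list:
  "(\<And>x. x \<in> set xs \<Longrightarrow> eventually (P x) F) \<Longrightarrow> eventually (\<lambda>p. \<forall>x\<in>set xs. P x p) F"
  by (simp add: eventually_ball_finite)

lemma eventually_Z_base:
  assumes "eventually P (unif (Z A L))"
  obtains F where "finite F" "F \<subseteq> carrier L"
    "\<And>\<theta> \<theta>'. \<theta> \<in> hom A L (Omega A) \<Longrightarrow> \<theta>' \<in> hom A L (Omega A) \<Longrightarrow> (\<forall>l\<in>F. \<theta> l = \<theta>' l) \<Longrightarrow> P (\<theta>, \<theta>')"
proof -
  let ?G = "\<lambda>l. filtercomap (\<lambda>(f, g). (f l, g l)) (principal (Id_on A))"
  from assms obtain F where F: "finite F" "F \<subseteq> carrier L"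
    and ev: "eventually (\<lambda>p. p \<in> hom A L (Omega A) \<times> hom A L (Omega A) \<longrightarrow> P p) (INF l\<in>F. ?G l)"
    unfolding unif_Z eventually_inf_principal eventually_INF[of _ _ "carrier L"] by blast
  obtain Q where Q: "\<And>l. l \<in> F \<Longrightarrow> eventually (Q l) (?G l)"
    and P: "\<And>p. (\<forall>l\<in>F. Q l p) \<Longrightarrow> p \<in> hom A L (Omega A) \<times> hom A L (Omega A) \<Longrightarrow> P p"
    using ev[unfolded eventually_INF_finite[OF F(1)]] by blast
  show thesis
  proof (rule that[OF F])
    fix \<theta> \<theta>' assume t: "\<theta> \<in> hom A L (Omega A)" "\<theta>' \<in> hom A L (Omega A)" "\<forall>l\<in>F. \<theta> l = \<theta>' l"
    have "Q l (\<theta>, \<theta>')" if "l \<in> F" for l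
    proof -
      have "\<theta> l \<in> A" "\<theta>' l = \<theta> l" using t that F by (auto simp: hom_def PiE_iff)
      then show ?thesis using Q[OF that]
        by (auto simp: eventually_filtercomap eventually_principal Id_on_def)
    qed
    then show "P (\<theta>, \<theta>')" using P t by auto
  qed
qed

lemma is_uspace_Z: "is_uspace (Z A L)"
  unfolding is_uspace_def
proof (intro conjI allI impI)
  show "unif (Z A L) \<le> principal (points (Z A L) \<times> points (Z A L))" by (rule unif_Z_le)
  fix E assume "eventually E (unif (Z A L))"
  then obtain F where F: "finite F" "F \<subseteq> carrier L"
    and E: "\<And>\<theta> \<theta>'. \<theta> \<in> hom A L (Omega A) \<Longrightarrow> \<theta>' \<in> hom A L (Omega A) \<Longrightarrow> (\<forall>l\<in>F. \<theta> l = \<theta>' l) \<Longrightarrow> E (\<theta>, \<theta>')"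
    by (rule eventually_Z_base) blast
  define D where "D = (\<lambda>(\<theta>, \<theta>'). \<theta> \<in> hom A L (Omega A) \<and> \<theta>' \<in> hom A L (Omega A) \<and> (\<forall>l\<in>F. \<theta> l = \<theta>' l))"
  have "eventually (\<lambda>p. p \<in> hom A L (Omega A) \<times> hom A L (Omega A)) (unif (Z A L))"
    using unif_Z_le[of A L] by (simp add: le_principal)
  moreover have "eventually (\<lambda>p. \<forall>l\<in>F. (case p of (\<theta>, \<theta>') \<Rightarrow> \<theta> l = \<theta>' l)) (unif (Z A L))"
    using F by (auto intro!: eventually_ball_finite eventually_Z)
  ultimately have D: "eventually D (unif (Z A L))"
    by eventually_elim (auto simp: D_def)
  show "\<forall>x\<in>points (Z A L). E (x, x)" using E by simp
  show "eventually (\<lambda>(x, y). E (y, x)) (unif (Z A L))"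
    by (rule eventually_mono[OF D]) (auto simp: D_def intro!: E)
  show "\<exists>D. eventually D (unif (Z A L)) \<and> (\<forall>x y z. D (x, y) \<longrightarrow> D (y, z) \<longrightarrow> E (x, z))"
  proof (intro exI conjI allI impI)
    show "eventually D (unif (Z A L))" by (rule D)
    fix x y z assume "D (x, y)" "D (y, z)"
    then show "E (x, z)" by (auto simp: D_def intro!: E)
  qed
qed

lemma B_closed:
  assumes "is_uspace X" "s \<in> syms A" "gs \<in> tuples (carrier (B A X)) (arity s)"
  shows "interp (B A X) s gs \<in> carrier (B A X)"
proof -
  have le: "unif X \<le> principal (points X \<times> points X)" using assms(1) by (simp add: is_uspace_def)
  have g: "g \<in> points X \<rightarrow>\<^sub>E A" "eventually (\<lambda>(x, y). g x = g y) (unif X)" if "g \<in> set gs" for g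
    using tuplesD(2)[OF assms(3) that] by (simp_all add: ucont_discrete_iff[OF le])
  have 1: "interp (B A X) s gs \<in> points X \<rightarrow>\<^sub>E A"
  proof -
    have "map (\<lambda>g. g x) gs \<in> tuples A (arity s)" if "x \<in> points X" for x
      using map_tuples[OF assms(3), of "\<lambda>g. g x" A] that by (auto simp: ucont_def discrete_uspace_def)
    then show ?thesis using omega_closed[OF assms(2)] by (simp add: interp_B)
  qed
  have "eventually (\<lambda>p. \<forall>g\<in>set gs. (case p of (x, y) \<Rightarrow> g x = g y)) (unif X)"
    by (rule eventually_ball_list) (rule g(2))
  moreover have "eventually (\<lambda>p. p \<in> points X \<times> points X) (unif X)"
    using le by (simp add: le_principal)
  ultimately have "eventually (\<lambda>(x, y). interp (B A X) s gs x = interp (B A X) s gs y) (unif X)"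
    apply eventually_elim
    apply (clarsimp simp: interp_B)
    apply (rule arg_cong[where f = "omega_interp s"])
    by simp
  then show ?thesis using 1 by (simp add: ucont_discrete_iff[OF le])
qed

lemma eval_term_B:
  assumes "is_uspace X" "t \<in> terms A" "range v \<subseteq> carrier (B A X)"
  shows "eval_term (B A X) v t \<in> carrier (B A X) \<and>
    (\<forall>x\<in>points X. eval_term (B A X) v t x = eval_term (Omega A) (\<lambda>i. v i x) t)"
  using assms(2)
proof induction
  case (1 i)
  then show ?case using assms(3) by auto
next
  case (2 s ts)
  have c: "map (eval_term (B A X) v) ts \<in> tuples (carrier (B A X)) (arity s)"
    using 2 by (auto simp: tuples_def)
  have "map (\<lambda>g. g x) (map (eval_term (B A X) v) ts) = map (eval_term (Omega A) (\<lambda>i. v i x)) ts"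
    if "x \<in> points X" for x
    using 2 that by auto
  then have "interp (B A X) s (map (eval_term (B A X) v) ts) x =
      omega_interp s (map (eval_term (Omega A) (\<lambda>i. v i x)) ts)" if "x \<in> points X" for x
    using that by (simp add: interp_B del: map_map)
  then show ?case using B_closed[OF assms(1) 2(1) c] by simp
qed

lemma in_variety_B:
  assumes "is_uspace X"
  shows "in_variety A (B A X)"
  unfolding in_variety_def
proof (intro conjI allI impI)
  show "is_algebra A (B A X)" unfolding is_algebra_def by (intro ballI B_closed[OF assms])
  fix E assume E: "E \<subseteq> terms A \<times> terms A" and m: "models (Omega A) E"
  show "models (B A X) E"
    unfolding models_def
  proof (clarify)
    fix t u and v :: "nat \<Rightarrow> _" assume tu: "(t, u) \<in> E" and v: "range v \<subseteq> carrier (B A X)"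
    have t: "t \<in> terms A" and u: "u \<in> terms A" using E tu by auto
    show "eval_term (B A X) v t = eval_term (B A X) v u"
    proof (rule PiE_ext)
      show "eval_term (B A X) v t \<in> points X \<rightarrow>\<^sub>E A" "eval_term (B A X) v u \<in> points X \<rightarrow>\<^sub>E A"
        using eval_term_B[OF assms t v] eval_term_B[OF assms u v] by (auto simp: ucont_def discrete_uspace_def)
      fix x assume x: "x \<in> points X"
      have "range (\<lambda>i. v i x) \<subseteq> A" using v x by (auto simp: ucont_def discrete_uspace_def PiE_iff)
      then have "eval_term (Omega A) (\<lambda>i. v i x) t = eval_term (Omega A) (\<lambda>i. v i x) u"
        using m tu by (auto simp: models_def)
      then show "eval_term (B A X) v t x = eval_term (B A X) v u x"
        using eval_term_B[OF assms t v] eval_term_B[OF assms u v] x by simp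
    qed
  qed
qed

lemma rho_in_B: "l \<in> carrier L \<Longrightarrow> rho A L l \<in> carrier (B A (Z A L))"
  unfolding carrier_B ucont_discrete_iff[OF unif_Z_le]
proof (intro conjI)
  assume l: "l \<in> carrier L"
  then show "rho A L l \<in> points (Z A L) \<rightarrow>\<^sub>E A"
    by (auto simp: rho_def hom_def)
  have "eventually (\<lambda>p. p \<in> hom A L (Omega A) \<times> hom A L (Omega A)) (unif (Z A L))"
    using unif_Z_le[of A L] by (simp add: le_principal)
  with eventually_Z[OF l, of A]
  show "eventually (\<lambda>(x, y). rho A L l x = rho A L l y) (unif (Z A L))"
    by eventually_elim (auto simp: rho_def l)
qed

lemma rho_hom:
  assumes "is_algebra A L"
  shows "rho A L \<in> hom A L (B A (Z A L))"
  unfolding hom_def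
proof (intro CollectI conjI ballI)
  show "rho A L \<in> carrier L \<rightarrow>\<^sub>E carrier (B A (Z A L))"
  proof (rule PiE_I)
    show "rho A L l \<in> carrier (B A (Z A L))" if "l \<in> carrier L" for l by (rule rho_in_B[OF that])
  qed (simp add: rho_def)
  fix s xs assume s: "s \<in> syms A" and xs: "xs \<in> tuples (carrier L) (arity s)"
  have c: "interp L s xs \<in> carrier L" using assms s xs by (auto simp: is_algebra_def)
  have "map (\<lambda>g. g \<theta>) (map (rho A L) xs) = map \<theta> xs" if "\<theta> \<in> hom A L (Omega A)" for \<theta>
    using that tuplesD[OF xs] by (auto simp: rho_def)
  moreover have "\<theta> (interp L s xs) = omega_interp s (map \<theta> xs)" if "\<theta> \<in> hom A L (Omega A)" for \<theta>
    using that s xs by (auto simp: hom_def)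
  ultimately show "rho A L (interp L s xs) = interp (B A (Z A L)) s (map (rho A L) xs)"
    using c by (auto simp: rho_def[of A L] interp_B simp del: map_map)
qed

lemma C_ucont:
  assumes "is_uspace X"
  shows "C A X \<in> ucont X (Z A (B A X))"
proof -
  have le: "unif X \<le> principal (points X \<times> points X)" using assms by (simp add: is_uspace_def)
  have ev: "eventually (\<lambda>p. p \<in> points X \<times> points X) (unif X)"
    using le by (simp add: le_principal)
  show ?thesis
    unfolding ucont_Z_iff[OF le]
  proof (intro conjI ballI PiE_I)
    fix x assume x: "x \<in> points X"
    show "C A X x \<in> hom A (B A X) (Omega A)"
      unfolding hom_def
    proof (intro CollectI conjI ballI)
      show "C A X x \<in> carrier (B A X) \<rightarrow>\<^sub>E carrier (Omega A)"
        using x by (auto simp: C_def ucont_def discrete_uspace_def)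
      fix s gs assume s: "s \<in> syms A" and gs: "gs \<in> tuples (carrier (B A X)) (arity s)"
      have "map (C A X x) gs = map (\<lambda>g. g x) gs"
        using tuplesD[OF gs] x by (auto simp: C_def)
      moreover have "C A X x (interp (B A X) s gs) = interp (B A X) s gs x"
        using B_closed[OF assms s gs] x by (simp add: C_def)
      ultimately show "C A X x (interp (B A X) s gs) = interp (Omega A) s (map (C A X x) gs)"
        using x by (simp add: interp_B del: map_eq_conv)
    qed
  next
    fix f assume f: "f \<in> carrier (B A X)"
    then have "eventually (\<lambda>(x, y). f x = f y) (unif X)"
      using ucont_discrete_iff[OF le] by auto
    with ev show "eventually (\<lambda>(x, y). C A X x f = C A X y f) (unif X)"
      by eventually_elim (use f in \<open>auto simp: C_def\<close>)
  qed (simp add: C_def)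
qed

lemma hom_compose:
  assumes "is_algebra A L" "\<phi> \<in> hom A L M" "\<theta> \<in> hom A M N"
  shows "compose (carrier L) \<theta> \<phi> \<in> hom A L N"
  unfolding hom_def
proof (intro CollectI conjI ballI)
  show "compose (carrier L) \<theta> \<phi> \<in> carrier L \<rightarrow>\<^sub>E carrier N"
    using assms by (auto simp: hom_def compose_def)
  fix s xs assume s: "s \<in> syms A" and xs: "xs \<in> tuples (carrier L) (arity s)"
  have c: "interp L s xs \<in> carrier L" using assms s xs by (auto simp: is_algebra_def)
  have m: "map \<phi> xs \<in> tuples (carrier M) (arity s)"
    by (rule map_tuples[OF xs]) (use assms(2) in \<open>auto simp: hom_def\<close>)
  have "map (compose (carrier L) \<theta> \<phi>) xs = map \<theta> (map \<phi> xs)"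
    using tuplesD[OF xs] by (auto simp: compose_def)
  moreover have "\<phi> (interp L s xs) = interp M s (map \<phi> xs)"
    using assms(2) s xs by (auto simp: hom_def)
  moreover have "\<theta> (interp M s (map \<phi> xs)) = interp N s (map \<theta> (map \<phi> xs))"
    using assms(3) s m unfolding hom_def by blast
  ultimately show "compose (carrier L) \<theta> \<phi> (interp L s xs) = interp N s (map (compose (carrier L) \<theta> \<phi>) xs)"
    using c by (simp add: compose_eq del: map_map)
qed

lemma Z_map_ucont:
  assumes "is_algebra A L" "\<phi> \<in> hom A L M"
  shows "Z_map A L M \<phi> \<in> ucont (Z A M) (Z A L)"
  unfolding ucont_Z_iff[OF unif_Z_le]
proof (intro conjI ballI PiE_I)
  fix \<theta> assume "\<theta> \<in> points (Z A M)"
  then show "Z_map A L M \<phi> \<theta> \<in> hom A L (Omega A)"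
    using hom_compose[OF assms] by (simp add: Z_map_def)
next
  fix l assume l: "l \<in> carrier L"
  then have "\<phi> l \<in> carrier M" using assms(2) by (auto simp: hom_def)
  from eventually_Z[OF this, of A]
  have "eventually (\<lambda>(\<theta>, \<theta>'). \<theta> (\<phi> l) = \<theta>' (\<phi> l)) (unif (Z A M))" .
  moreover have "eventually (\<lambda>p. p \<in> hom A M (Omega A) \<times> hom A M (Omega A)) (unif (Z A M))"
    using unif_Z_le[of A M] by (simp add: le_principal)
  ultimately show "eventually (\<lambda>(x, y). Z_map A L M \<phi> x l = Z_map A L M \<phi> y l) (unif (Z A M))"
    by eventually_elim (auto simp: Z_map_def compose_eq l)
qed (simp add: Z_map_def)

lemma B_map_hom:
  assumes "is_uspace X" "is_uspace Y" "f \<in> ucont X Y"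
  shows "B_map A X Y f \<in> hom A (B A Y) (B A X)"
  unfolding hom_def
proof (intro CollectI conjI ballI)
  have le: "unif X \<le> principal (points X \<times> points X)" using assms by (simp add: is_uspace_def)
  have ev: "eventually (\<lambda>p. p \<in> points X \<times> points X) (unif X)"
    using le by (simp add: le_principal)
  have leY: "unif Y \<le> principal (points Y \<times> points Y)" using assms by (simp add: is_uspace_def)
  have f: "f \<in> points X \<rightarrow>\<^sub>E points Y" "LIM (x, y) unif X. (f x, f y) :> unif Y"
    using assms(3) by (auto simp: ucont_def)
  show "B_map A X Y f \<in> carrier (B A Y) \<rightarrow>\<^sub>E carrier (B A X)"
  proof (rule PiE_I)
    fix g assume g: "g \<in> carrier (B A Y)"
    then have g': "g \<in> points Y \<rightarrow>\<^sub>E A" "eventually (\<lambda>(x, y). g x = g y) (unif Y)"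
      by (auto simp: ucont_discrete_iff[OF leY])
    have "eventually (\<lambda>p. case (case p of (x, y) \<Rightarrow> (f x, f y)) of (x, y) \<Rightarrow> g x = g y) (unif X)"
      using g'(2) f(2) by (auto simp: filterlim_iff)
    with ev have "eventually (\<lambda>(x, y). compose (points X) g f x = compose (points X) g f y) (unif X)"
      by eventually_elim (auto simp: compose_eq)
    then show "B_map A X Y f g \<in> carrier (B A X)"
      using g g'(1) f(1) by (auto simp: B_map_def ucont_discrete_iff[OF le] compose_def)
  qed (simp add: B_map_def)
  fix s gs assume s: "s \<in> syms A" and gs: "gs \<in> tuples (carrier (B A Y)) (arity s)"
  have "map (\<lambda>g. g x) (map (B_map A X Y f) gs) = map (\<lambda>g. g (f x)) gs" if "x \<in> points X" for x
    using that tuplesD[OF gs] by (auto simp: B_map_def compose_eq)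
  moreover have "B_map A X Y f (interp (B A Y) s gs) = compose (points X) (interp (B A Y) s gs) f"
    using B_closed[OF assms(2) s gs] by (simp add: B_map_def)
  moreover have "f x \<in> points Y" if "x \<in> points X" for x using f(1) that by auto
  ultimately show "B_map A X Y f (interp (B A Y) s gs) = interp (B A X) s (map (B_map A X Y f) gs)"
    by (auto simp: interp_B compose_def fun_eq_iff simp del: map_map)
qed

end

theory Submission
  imports Defs
begin

text \<open>
  A uniformly continuous map \<open>g\<close> from \<open>Z(L)\<close> to the discrete space \<open>A\<close> depends on finitely many
  coordinates only, so \<open>g(\<theta>) = f(\<theta>(l\<^sub>1), \<dots>, \<theta>(l\<^sub>n))\<close> for some \<open>f : A\<^sup>n \<rightarrow> A\<close>. As \<open>f\<close> is a basic
  operation of \<open>\<Omega>(A)\<close>, every homomorphism commutes with it; this determines a homomorphism on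
  \<open>\<BB>\<^sub>A(Z(L))\<close> by its values on the image of \<open>\<rho>\<close>, and shows that a map in
  \<open>\<BB>\<^sub>A(Z(\<BB>\<^sub>A(X)))\<close> is determined by its values on the image of \<open>\<C>\<close>.
\<close>

section \<open>Membership and evaluation rules for homomorphisms and uniformly continuous
  maps\<close>

lemma in_variety_is_algebra: "in_variety A L \<Longrightarrow> is_algebra A L"
  by (simp add: in_variety_def)

lemma hom_in_carrier: "h \<in> hom A L M \<Longrightarrow> l \<in> carrier L \<Longrightarrow> h l \<in> carrier M"
  by (auto simp: hom_def)

lemma hom_extensional: "h \<in> hom A L M \<Longrightarrow> h \<in> extensional (carrier L)"
  by (auto simp: hom_def PiE_iff)

lemma hom_interp:
  "h \<in> hom A L M \<Longrightarrow> s \<in> syms A \<Longrightarrow> xs \<in> tuples (carrier L) (arity s) \<Longrightarrow>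
    h (interp L s xs) = interp M s (map h xs)"
  by (simp add: hom_def)

lemma ucont_in_points: "f \<in> ucont X Y \<Longrightarrow> x \<in> points X \<Longrightarrow> f x \<in> points Y"
  by (auto simp: ucont_def)

lemma ucont_extensional: "f \<in> ucont X Y \<Longrightarrow> f \<in> extensional (points X)"
  by (auto simp: ucont_def PiE_iff)

lemma C_in_hom: "is_uspace X \<Longrightarrow> x \<in> points X \<Longrightarrow> C A X x \<in> hom A (B A X) (Omega A)"
  using ucont_in_points[OF C_ucont] by fastforce

lemma C_apply [simp]: "x \<in> points X \<Longrightarrow> f \<in> carrier (B A X) \<Longrightarrow> C A X x f = f x"
  by (simp add: C_def)

lemma rho_apply [simp]: "l \<in> carrier L \<Longrightarrow> \<phi> \<in> points (Z A L) \<Longrightarrow> rho A L l \<phi> = \<phi> l"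
  by (simp add: rho_def)

lemma Z_map_apply [simp]:
  "\<theta> \<in> points (Z A M) \<Longrightarrow> l \<in> carrier L \<Longrightarrow> Z_map A L M \<phi> \<theta> l = \<theta> (\<phi> l)"
  by (simp add: Z_map_def compose_eq)

lemma B_map_apply [simp]:
  "g \<in> carrier (B A Y) \<Longrightarrow> x \<in> points X \<Longrightarrow> B_map A X Y f g x = g (f x)"
  by (simp add: B_map_def compose_eq)

lemma Fn_in_syms: "f \<in> tuples A n \<rightarrow>\<^sub>E A \<Longrightarrow> Fn n f \<in> syms A"
  by (auto simp: syms_def)

section \<open>Naturality of \<open>C\<close> and \<open>rho\<close>\<close>

text \<open>Both composites send \<open>x\<close> to the functional taking \<open>g\<close> to
  \<open>g (f x)\<close>. Extensionality is applied twice, over \<open>points X\<close> and then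
  over \<open>carrier (B A Y)\<close>; apart from that, only membership in the right carriers has to
  be checked.\<close>

lemma C_natural:
  assumes X: "is_uspace X" and Y: "is_uspace Y" and f: "f \<in> ucont X Y"
  shows "compose (points X) (Z_map A (B A Y) (B A X) (B_map A X Y f)) (C A X)
    = compose (points X) (C A Y) f"
proof (rule extensionalityI[OF compose_extensional compose_extensional])
  fix x assume x: "x \<in> points X"
  have fx: "f x \<in> points Y" by (rule ucont_in_points[OF f x])
  have B: "B_map A X Y f \<in> hom A (B A Y) (B A X)" by (rule B_map_hom[OF X Y f])
  have alg: "is_algebra A (B A Y)" by (rule in_variety_is_algebra[OF in_variety_B[OF Y]])
  have Cx: "C A X x \<in> points (Z A (B A X))" using C_in_hom[OF X x] by simp
  have "Z_map A (B A Y) (B A X) (B_map A X Y f) (C A X x) \<in> hom A (B A Y) (Omega A)"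
    using ucont_in_points[OF Z_map_ucont[OF alg B] Cx] by simp
  then have "Z_map A (B A Y) (B A X) (B_map A X Y f) (C A X x) = C A Y (f x)"
  proof (rule extensionalityI[OF hom_extensional hom_extensional[OF C_in_hom[OF Y fx]]])
    fix g assume g: "g \<in> carrier (B A Y)"
    show "Z_map A (B A Y) (B A X) (B_map A X Y f) (C A X x) g = C A Y (f x) g"
      using Cx g x fx hom_in_carrier[OF B g] by (simp del: points_Z carrier_B)
  qed
  then show "compose (points X) (Z_map A (B A Y) (B A X) (B_map A X Y f)) (C A X) x
      = compose (points X) (C A Y) f x"
    using x by (simp add: compose_eq)
qed

text \<open>Dual to \<open>C_natural\<close>: both composites send \<open>l\<close> to the map
  taking \<open>\<theta>\<close> to \<open>\<theta> (\<phi> l)\<close>.\<close>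

lemma rho_natural:
  assumes L: "is_algebra A L" and \<phi>: "\<phi> \<in> hom A L M"
  shows "compose (carrier L) (B_map A (Z A M) (Z A L) (Z_map A L M \<phi>)) (rho A L)
    = compose (carrier L) (rho A M) \<phi>"
proof (rule extensionalityI[OF compose_extensional compose_extensional])
  fix l assume l: "l \<in> carrier L"
  have \<phi>l: "\<phi> l \<in> carrier M" by (rule hom_in_carrier[OF \<phi> l])
  have Z: "Z_map A L M \<phi> \<in> ucont (Z A M) (Z A L)" by (rule Z_map_ucont[OF L \<phi>])
  have r: "rho A L l \<in> carrier (B A (Z A L))" by (rule rho_in_B[OF l])
  have "B_map A (Z A M) (Z A L) (Z_map A L M \<phi>) (rho A L l) \<in> carrier (B A (Z A M))"
    by (rule hom_in_carrier[OF B_map_hom[OF is_uspace_Z is_uspace_Z Z] r])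
  moreover have "rho A M (\<phi> l) \<in> carrier (B A (Z A M))" by (rule rho_in_B[OF \<phi>l])
  ultimately have "B_map A (Z A M) (Z A L) (Z_map A L M \<phi>) (rho A L l) = rho A M (\<phi> l)"
    unfolding carrier_B
  proof (rule extensionalityI[OF ucont_extensional ucont_extensional])
    fix \<theta> assume t: "\<theta> \<in> points (Z A M)"
    show "B_map A (Z A M) (Z A L) (Z_map A L M \<phi>) (rho A L l) \<theta> = rho A M (\<phi> l) \<theta>"
      using t l \<phi>l r ucont_in_points[OF Z t] by (simp del: points_Z carrier_B)
  qed
  then show "compose (carrier L) (B_map A (Z A M) (Z A L) (Z_map A L M \<phi>)) (rho A L) l
      = compose (carrier L) (rho A M) \<phi> l"
    using l by (simp add: compose_eq)
qed

section \<open>Finite dependence of uniformly continuous maps on \<open>Z A L\<close>\<close>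

text \<open>A basic entourage of \<open>Z A L\<close> constrains only finitely many coordinates, so
  \<open>g\<close> factors through restriction to a finite list \<open>ls\<close>. The factor is
  extended to all tuples over \<open>A\<close>, which makes it an operation of
  \<open>Omega A\<close>.\<close>

lemma ucont_Z_finitary:
  assumes "A \<noteq> {}" and g: "g \<in> carrier (B A (Z A L))"
  obtains ls f where "set ls \<subseteq> carrier L" "f \<in> tuples A (length ls) \<rightarrow>\<^sub>E A"
    "\<And>\<theta>. \<theta> \<in> hom A L (Omega A) \<Longrightarrow> g \<theta> = f (map \<theta> ls)"
proof -
  let ?H = "hom A L (Omega A)"
  obtain a where a: "a \<in> A" using assms(1) by blast
  have gA: "g \<in> ?H \<rightarrow>\<^sub>E A" and "eventually (\<lambda>(\<theta>, \<theta>'). g \<theta> = g \<theta>') (unif (Z A L))"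
    using g by (simp_all add: ucont_discrete_iff[OF unif_Z_le])
  from eventually_Z_base[OF this(2)] obtain F where "finite F" and FL: "F \<subseteq> carrier L"
    and dep: "\<And>\<theta> \<theta>'. \<theta> \<in> ?H \<Longrightarrow> \<theta>' \<in> ?H \<Longrightarrow> \<forall>l\<in>F. \<theta> l = \<theta>' l \<Longrightarrow> g \<theta> = g \<theta>'"
    by (metis (mono_tags, lifting) case_prod_conv)
  then obtain ls where ls: "set ls = F" using finite_list by blast
  \<comment> \<open>A tuple realised by some homomorphism receives the value of \<open>g\<close> at
    a chosen one; the remaining tuples receive the default \<open>a\<close>, since an operation
    symbol needs a total function.\<close>
  define f where "f = (\<lambda>xs\<in>tuples A (length ls).
    if \<exists>\<theta>\<in>?H. map \<theta> ls = xs then g (SOME \<theta>. \<theta> \<in> ?H \<and> map \<theta> ls = xs) else a)"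
  have some: "(SOME \<theta>'. \<theta>' \<in> ?H \<and> map \<theta>' ls = map \<theta> ls) \<in> ?H \<and>
      map (SOME \<theta>'. \<theta>' \<in> ?H \<and> map \<theta>' ls = map \<theta> ls) ls = map \<theta> ls" if "\<theta> \<in> ?H" for \<theta>
    by (rule someI[where P = "\<lambda>\<theta>'. \<theta>' \<in> ?H \<and> map \<theta>' ls = map \<theta> ls" and x = \<theta>]) (use that in simp)
  show thesis
  proof
    show "set ls \<subseteq> carrier L" using ls FL by simp
    show "f \<in> tuples A (length ls) \<rightarrow>\<^sub>E A"
    proof (rule PiE_I)
      fix xs assume xs: "xs \<in> tuples A (length ls)"
      show "f xs \<in> A"
      proof (cases "\<exists>\<theta>\<in>?H. map \<theta> ls = xs")
        case True
        then obtain \<theta> where "\<theta> \<in> ?H" "xs = map \<theta> ls" by blast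
        then show ?thesis using xs some gA by (auto simp: f_def)
      qed (use a xs in \<open>auto simp: f_def\<close>)
    qed (simp add: f_def)
    fix \<theta> assume t: "\<theta> \<in> ?H"
    have "map \<theta> ls \<in> tuples A (length ls)"
      using t ls FL hom_in_carrier[OF t] by (auto simp: tuples_def)
    then have "f (map \<theta> ls) = g (SOME \<theta>'. \<theta>' \<in> ?H \<and> map \<theta>' ls = map \<theta> ls)"
      using t by (auto simp: f_def simp del: map_eq_conv)
    \<comment> \<open>The chosen homomorphism may differ from \<open>\<theta>\<close>, but the two
      agree on \<open>F\<close>, so \<open>dep\<close> makes the value independent of the
      choice.\<close>
    moreover have "g \<theta> = g (SOME \<theta>'. \<theta>' \<in> ?H \<and> map \<theta>' ls = map \<theta> ls)"
      using some[OF t] by (intro dep[OF t]) (auto simp: ls)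
    ultimately show "g \<theta> = f (map \<theta> ls)" by simp
  qed
qed

section \<open>Homomorphisms on \<open>B\<close> and uniformly continuous maps on \<open>Z\<close>
  as evaluations\<close>

text \<open>By finite dependence, \<open>g\<close> is a basic operation applied to elements
  \<open>rho A L l\<close>, and \<open>\<Phi>\<close> commutes with that operation. Hence
  \<open>\<Phi>\<close> is evaluation at the point \<open>\<Phi>\<close> composed with
  \<open>rho\<close>, which gives surjectivity of \<open>C A (Z A L)\<close>.\<close>

lemma hom_B_Z_eq_eval:
  assumes "A \<noteq> {}" and L: "is_algebra A L" and \<Phi>: "\<Phi> \<in> hom A (B A (Z A L)) (Omega A)"
    and g: "g \<in> carrier (B A (Z A L))"
  shows "\<Phi> g = g (compose (carrier L) \<Phi> (rho A L))"
proof -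
  obtain ls f where ls: "set ls \<subseteq> carrier L" and f: "f \<in> tuples A (length ls) \<rightarrow>\<^sub>E A"
    and gf: "\<And>\<theta>. \<theta> \<in> hom A L (Omega A) \<Longrightarrow> g \<theta> = f (map \<theta> ls)"
    using ucont_Z_finitary[OF assms(1) g] by blast
  let ?rs = "map (rho A L) ls"
  have rs: "?rs \<in> tuples (carrier (B A (Z A L))) (arity (Fn (length ls) f))"
    using ls rho_in_B[of _ L A] by (auto simp: tuples_def simp del: carrier_B)
  have "interp (B A (Z A L)) (Fn (length ls) f) ?rs \<in> carrier (B A (Z A L))"
    by (rule B_closed[OF is_uspace_Z Fn_in_syms[OF f] rs])
  \<comment> \<open>At each \<open>\<theta>\<close> the arguments \<open>rho A L l\<close> take the
    values \<open>\<theta> l\<close>, so the operation returns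
    \<open>f (map \<theta> ls)\<close>.\<close>
  with g have "g = interp (B A (Z A L)) (Fn (length ls) f) ?rs"
    unfolding carrier_B
  proof (rule extensionalityI[OF ucont_extensional ucont_extensional])
    fix \<theta> assume t: "\<theta> \<in> points (Z A L)"
    have "map (\<lambda>r. r \<theta>) ?rs = map \<theta> ls"
      using t ls by (auto simp del: points_Z)
    with t show "g \<theta> = interp (B A (Z A L)) (Fn (length ls) f) ?rs \<theta>"
      using gf by (simp add: interp_B del: map_map map_eq_conv)
  qed
  then have "\<Phi> g = f (map \<Phi> ?rs)"
    using hom_interp[OF \<Phi> Fn_in_syms[OF f] rs] by simp
  also have "map \<Phi> ?rs = map (compose (carrier L) \<Phi> (rho A L)) ls"
    using ls by (auto simp: compose_eq)
  \<comment> \<open>The composite is itself a homomorphism from \<open>L\<close> to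
    \<open>Omega A\<close>, so the finitary formula for \<open>g\<close> can be read backwards
    there.\<close>
  also have "f \<dots> = g (compose (carrier L) \<Phi> (rho A L))"
    by (rule gf[OF hom_compose[OF L rho_hom[OF L] \<Phi>], symmetric])
  finally show ?thesis .
qed

text \<open>Here the finitely many coordinates \<open>gs\<close> are themselves elements of
  \<open>B A X\<close>. The pullback of \<open>G\<close> along \<open>C\<close> is \<open>f\<close>
  applied to them pointwise, and \<open>\<theta>\<close> commutes with \<open>f\<close>. Thus
  \<open>G\<close> is recovered from its values on the image of \<open>C\<close>.\<close>

lemma B_Z_B_eq_eval:
  assumes "A \<noteq> {}" and X: "is_uspace X" and G: "G \<in> carrier (B A (Z A (B A X)))"
    and \<theta>: "\<theta> \<in> hom A (B A X) (Omega A)"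
  shows "G \<theta> = \<theta> (B_map A X (Z A (B A X)) (C A X) G)"
proof -
  obtain gs f where gs: "set gs \<subseteq> carrier (B A X)" and f: "f \<in> tuples A (length gs) \<rightarrow>\<^sub>E A"
    and Gf: "\<And>\<theta>. \<theta> \<in> hom A (B A X) (Omega A) \<Longrightarrow> G \<theta> = f (map \<theta> gs)"
    using ucont_Z_finitary[OF assms(1) G] by blast
  have gs': "gs \<in> tuples (carrier (B A X)) (arity (Fn (length gs) f))"
    using gs by (simp add: tuples_def)
  have "B_map A X (Z A (B A X)) (C A X) G \<in> carrier (B A X)"
    by (rule hom_in_carrier[OF B_map_hom[OF X is_uspace_Z C_ucont[OF X]] G])
  moreover have "interp (B A X) (Fn (length gs) f) gs \<in> carrier (B A X)"
    by (rule B_closed[OF X Fn_in_syms[OF f] gs'])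
  \<comment> \<open>At \<open>x\<close> the homomorphism \<open>C A X x\<close> evaluates every
    entry of \<open>gs\<close> at \<open>x\<close>, so both sides equal \<open>f\<close> of those
    values.\<close>
  ultimately have "B_map A X (Z A (B A X)) (C A X) G = interp (B A X) (Fn (length gs) f) gs"
    unfolding carrier_B
  proof (rule extensionalityI[OF ucont_extensional ucont_extensional])
    fix x assume x: "x \<in> points X"
    have "map (C A X x) gs = map (\<lambda>g. g x) gs" using gs x by (auto simp del: carrier_B)
    then show "B_map A X (Z A (B A X)) (C A X) G x = interp (B A X) (Fn (length gs) f) gs x"
      using x G Gf[OF C_in_hom[OF X x]] by (simp add: interp_B del: carrier_B map_eq_conv)
  qed
  then show ?thesis
    using hom_interp[OF \<theta> Fn_in_syms[OF f] gs'] Gf[OF \<theta>] by simp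
qed

section \<open>The inverse pairs\<close>

text \<open>Recovering \<open>\<Phi>\<close> is \<open>hom_B_Z_eq_eval\<close>. Recovering
  \<open>\<theta>\<close> is evaluation alone: \<open>C A (Z A L) \<theta>\<close> at
  \<open>rho A L l\<close> is \<open>\<theta> l\<close>.\<close>

lemma Z_rho_C_mutually_inverse:
  assumes "A \<noteq> {}" and L: "is_algebra A L"
  shows "mutually_inverse (points (Z A (B A (Z A L)))) (points (Z A L))
    (Z_map A L (B A (Z A L)) (rho A L)) (C A (Z A L))"
  unfolding mutually_inverse_def
proof (intro conjI ballI)
  show Z: "Z_map A L (B A (Z A L)) (rho A L) \<in> points (Z A (B A (Z A L))) \<rightarrow>\<^sub>E points (Z A L)"
    using Z_map_ucont[OF L rho_hom[OF L]] by (simp add: ucont_def)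
  show C: "C A (Z A L) \<in> points (Z A L) \<rightarrow>\<^sub>E points (Z A (B A (Z A L)))"
    using C_ucont[OF is_uspace_Z[of A L], of A] by (simp add: ucont_def)
  show "C A (Z A L) (Z_map A L (B A (Z A L)) (rho A L) \<Phi>) = \<Phi>"
    if P: "\<Phi> \<in> points (Z A (B A (Z A L)))" for \<Phi>
  proof -
    have \<Phi>: "\<Phi> \<in> hom A (B A (Z A L)) (Omega A)" using P by simp
    have z: "Z_map A L (B A (Z A L)) (rho A L) \<Phi> \<in> points (Z A L)" by (rule PiE_mem[OF Z P])
    show ?thesis
    proof (rule extensionalityI[OF hom_extensional[OF C_in_hom[OF is_uspace_Z z]] hom_extensional[OF \<Phi>]])
      fix g assume g: "g \<in> carrier (B A (Z A L))"
      \<comment> \<open>\<open>Z_map\<close> is unfolded to the whole composite, because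
        \<open>g\<close> takes that homomorphism as its argument.\<close>
      have "C A (Z A L) (Z_map A L (B A (Z A L)) (rho A L) \<Phi>) g = g (compose (carrier L) \<Phi> (rho A L))"
        using z g P by (simp add: Z_map_def del: carrier_B points_Z)
      then show "C A (Z A L) (Z_map A L (B A (Z A L)) (rho A L) \<Phi>) g = \<Phi> g"
        using hom_B_Z_eq_eval[OF assms(1) L \<Phi> g] by simp
    qed
  qed
  show "Z_map A L (B A (Z A L)) (rho A L) (C A (Z A L) \<theta>) = \<theta>" if t: "\<theta> \<in> points (Z A L)" for \<theta>
  proof -
    have c: "C A (Z A L) \<theta> \<in> points (Z A (B A (Z A L)))" by (rule PiE_mem[OF C t])
    have "Z_map A L (B A (Z A L)) (rho A L) (C A (Z A L) \<theta>) \<in> points (Z A L)"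
      by (rule PiE_mem[OF Z c])
    then show ?thesis using t unfolding points_Z
    proof (rule extensionalityI[OF hom_extensional hom_extensional])
      fix l assume l: "l \<in> carrier L"
      show "Z_map A L (B A (Z A L)) (rho A L) (C A (Z A L) \<theta>) l = \<theta> l"
        using c l t rho_in_B[OF l, of A] by (simp del: carrier_B points_Z)
    qed
  qed
qed

text \<open>Recovering \<open>G\<close> is \<open>B_Z_B_eq_eval\<close>, since \<open>rho\<close> of
  the pullback takes \<open>\<theta>\<close> to its value at that pullback. Recovering
  \<open>g\<close> is evaluation alone: \<open>rho A (B A X) g\<close> at \<open>C A X x\<close> is
  \<open>g x\<close>.\<close>

lemma B_C_rho_mutually_inverse:
  assumes "A \<noteq> {}" and X: "is_uspace X"
  shows "mutually_inverse (carrier (B A (Z A (B A X)))) (carrier (B A X))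
    (B_map A X (Z A (B A X)) (C A X)) (rho A (B A X))"
  unfolding mutually_inverse_def
proof (intro conjI ballI)
  show b: "B_map A X (Z A (B A X)) (C A X) \<in> carrier (B A (Z A (B A X))) \<rightarrow>\<^sub>E carrier (B A X)"
    using B_map_hom[OF X is_uspace_Z C_ucont[OF X, of A], of A] by (simp add: hom_def)
  show r: "rho A (B A X) \<in> carrier (B A X) \<rightarrow>\<^sub>E carrier (B A (Z A (B A X)))"
    using rho_hom[OF in_variety_is_algebra[OF in_variety_B[OF X, of A]]] by (simp add: hom_def)
  show "rho A (B A X) (B_map A X (Z A (B A X)) (C A X) G) = G"
    if G: "G \<in> carrier (B A (Z A (B A X)))" for G
  proof -
    have bG: "B_map A X (Z A (B A X)) (C A X) G \<in> carrier (B A X)" by (rule PiE_mem[OF b G])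
    have "rho A (B A X) (B_map A X (Z A (B A X)) (C A X) G) \<in> carrier (B A (Z A (B A X)))"
      by (rule rho_in_B[OF bG])
    then show ?thesis using G unfolding carrier_B
    proof (rule extensionalityI[OF ucont_extensional ucont_extensional])
      fix \<theta> assume t: "\<theta> \<in> points (Z A (B A X))"
      then show "rho A (B A X) (B_map A X (Z A (B A X)) (C A X) G) \<theta> = G \<theta>"
        using bG B_Z_B_eq_eval[OF assms(1) X G] by (simp del: carrier_B)
    qed
  qed
  show "B_map A X (Z A (B A X)) (C A X) (rho A (B A X) g) = g" if g: "g \<in> carrier (B A X)" for g
  proof -
    have rg: "rho A (B A X) g \<in> carrier (B A (Z A (B A X)))" by (rule PiE_mem[OF r g])
    have "B_map A X (Z A (B A X)) (C A X) (rho A (B A X) g) \<in> carrier (B A X)"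
      by (rule PiE_mem[OF b rg])
    then show ?thesis using g unfolding carrier_B
    proof (rule extensionalityI[OF ucont_extensional ucont_extensional])
      fix x assume x: "x \<in> points X"
      have "C A X x \<in> points (Z A (B A X))" using C_in_hom[OF X x] by simp
      then show "B_map A X (Z A (B A X)) (C A X) (rho A (B A X) g) x = g x"
        using x g rg by (simp del: carrier_B points_Z)
    qed
  qed
qed

theorem theorem1p4:
  fixes A :: "'a set"
  assumes "infinite A"
  shows
    "(\<forall>(X :: 'x uspace) (Y :: 'y uspace) f.
        is_uspace X \<longrightarrow> is_uspace Y \<longrightarrow> f \<in> ucont X Y \<longrightarrow>
        compose (points X) (Z_map A (B A Y) (B A X) (B_map A X Y f)) (C A X)
          = compose (points X) (C A Y) f) \<and>
     (\<forall>(L :: ('a, 'l) algebra) (M :: ('a, 'm) algebra) \<phi>.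
        in_variety A L \<longrightarrow> in_variety A M \<longrightarrow> \<phi> \<in> hom A L M \<longrightarrow>
        compose (carrier L) (B_map A (Z A M) (Z A L) (Z_map A L M \<phi>)) (rho A L)
          = compose (carrier L) (rho A M) \<phi>) \<and>
     (\<forall>L :: ('a, 'k) algebra.
        in_variety A L \<longrightarrow>
        mutually_inverse (points (Z A (B A (Z A L)))) (points (Z A L))
          (Z_map A L (B A (Z A L)) (rho A L)) (C A (Z A L))) \<and>
     (\<forall>X :: 'w uspace.
        is_uspace X \<longrightarrow>
        mutually_inverse (carrier (B A (Z A (B A X)))) (carrier (B A X))
          (B_map A X (Z A (B A X)) (C A X)) (rho A (B A X)))"
proof -
  \<comment> \<open>Nonemptiness supplies the default value in \<open>ucont_Z_finitary\<close>, on
    which both inverse pairs rest.\<close>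
  have "A \<noteq> {}" using assms by auto
  then show ?thesis
    by (intro conjI allI impI C_natural rho_natural Z_rho_C_mutually_inverse
        B_C_rho_mutually_inverse in_variety_is_algebra)
qed

end
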